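(* If $\rho:\Gamma\to\mathrm{GL}(d,\mathbb R)$ is $1$-almost dominated relative to $\mathcal P$, then $\rho$ is discrete and faithful.
   Context: Setting. $\Gamma$ is a finitely generated torsion-free group, $\mathcal P$ is a finite collection of finitely generated proper infinite subgroups of $\Gamma$, and $S=S^{-1}$ is a finite generating set of $\Gamma$ such that $S\cap P$ generates $P$ for each $P\in\mathcal P$. Conjugates of elements of $\mathcal P$ are called peripheral subgroups. An element of $\Gamma$ is peripheral if it lies in a peripheral subgroup, and non-peripheral otherwise. The left cosets $gP$ ($g\in\Gamma$, $P\in\mathcal P$) are the peripheral cosets. Cusped space. The combinatorial horoball $\mathcal H(\Lambda)$ on a graph $\Lambda$ is the graph with vertex set $\Lambda^{(0)}\times\mathbb Z_{\ge 0}$, a horizontal edge between $(v,k)$ and $(w,k)$ whenever $0<d_\Lambda(v,w)\le 2^k$, and a vertical edge between $(v,k)$ and $(v,k+1)$; all edges have length $1$. The cusped space $X=X(\Gamma,\mathcal P,S)$ is obtained from the Cayley graph $\mathrm{Cay}(\Gamma)=\mathrm{Cay}(\Gamma,S)$ by gluing a combinatorial horoball $\mathcal H(tP)$ on each peripheral coset $tP\subset \mathrm{Cay}(\Gamma)$ along its level $0$. $d_c$ is the path metric on $X$, $|\gamma|_c:=d_c(\mathrm{id},\gamma)$, and $|\gamma|$ is the word length with respect to $S$. Paths. A peripheral excursion of a path in $X$ is a maximal subpath lying in a closed combinatorial horoball. A preferred geodesic in a horoball is a geodesic consisting of at most two vertical segments and a single horizontal segment of length at most $3$. If $\hat\gamma:I\to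 X$ is a path with endpoints (if any) in $\mathrm{Cay}(\Gamma)$ whose peripheral excursions are preferred geodesics, its projection $\pi\circ\hat\gamma:I\to\mathrm{Cay}(\Gamma)$ replaces each excursion by a geodesic path with the same endpoints in the Cayley graph of the corresponding peripheral coset (omit the vertical segments and replace the horizontal segment by the corresponding segment at level $0$, run at constant speed). If $\hat\gamma$ is geodesic, $\pi\circ\hat\gamma$ is called a projected geodesic. For a path $\gamma:I\to\mathrm{Cay}(\Gamma)$ where $I$ has integer (or infinite) endpoints and $\gamma(I\cap\mathbb Z)\subset\Gamma$, the depth $\delta(n)$ of $\gamma(n)$ is the smallest integer $d$ such that at least one of $\gamma(n-d),\gamma(n+d)$ is defined and not in the same peripheral coset as $\gamma(n)$, or, if there is no such integer, $\min\{\sup I-n,\,n-\inf I\}$. For $\underline\upsilon,\overline\upsilon>0$, $\gamma$ is a $(\underline\upsilon,\overline\upsilon)$-metric quasigeodesic path if for all integers $m,n\in I$: (i) $|\gamma(n)^{-1}\gamma(m)|_c\ge\underline\upsilon^{-1}|m-n|-\underline\upsilon$; (ii) $|\gamma(n)^{-1}\gamma(m)|_c\le\overline\upsilon(|m-n|+\min\{\delta(m),\delta(n)\})+\overline\upsilon$; (iii) if $\gamma(n)^{-1}\gamma(n+1)\in P$ for some $P\in\mathcal P$, then $\gamma(n)^{-1}\gamma(n+1)=p_{n,1}\cdots p_{n,\ell(n)}$ with each $p_{n,i}$ a peripheral generator of $P$ and $2^{\delta(n)-1}\le\ell(n)=|\gamma(n)^{-1}\gamma(n+1)|\le 2^{\delta(n)+1}$.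 Words are regarded as the (suitably parametrized) paths they trace in $\mathrm{Cay}(\Gamma)$. Condition (RH) on $\mathcal P$ (assumed throughout): (malnormality) for $\gamma\in\Gamma$ and $P,P'\in\mathcal P$, $\gamma P\gamma^{-1}\cap P'=1$ unless $\gamma\in P=P'$; (non-distortion) there is $\nu>0$ with $|\gamma^n|_c\ge\nu|n|$ for every infinite-order non-peripheral $\gamma$; (local-to-global) there are $\underline\upsilon,\overline\upsilon,L>0$ such that if $p=p_1\cdots p_n$ is a geodesic word in some $P\in\mathcal P$, $n>L$, and $\gamma p_1\cdots p_L$ is a projected geodesic, then $\gamma p$ is a $(\underline\upsilon,\overline\upsilon)$-metric quasigeodesic path. For $g\in \mathrm{GL}(d,\mathbb R)$, $\sigma_1(g)\ge\dots\ge\sigma_d(g)$ are the singular values. $\rho$ is $1$-almost dominated relative to $\mathcal P$ (with lower domination constants $\underline C,\underline\mu>0$) if $\mathcal P$ satisfies (RH) and $\frac{\sigma_1}{\sigma_2}(\rho(\gamma))\ge\underline Ce^{\underline\mu|\gamma|_c}$ for all $\gamma\in\Gamma$. *)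

theory Defs
  imports "HOL-Analysis.Analysis" "HOL-Algebra.Coset" "HOL-Algebra.Generated_Groups"
begin

section \<open>Graphs\<close>

text \<open>A graph with edges of length 1 is given by its symmetric set of edges. Only connected graphs
  are of interest: \<open>gdist\<close> is the path metric on vertices and is unspecified
  for vertices in different components.\<close>

definition gdist :: "('v \<times> 'v) set \<Rightarrow> 'v \<Rightarrow> 'v \<Rightarrow> nat" where
  "gdist E x y = (LEAST n. (x, y) \<in> E ^^ n)"

definition edge_path :: "('v \<times> 'v) set \<Rightarrow> 'v list \<Rightarrow> bool" where
  "edge_path E xs \<longleftrightarrow> xs \<noteq> [] \<and> (\<forall>i. Suc i < length xs \<longrightarrow> (xs ! i, xs ! Suc i) \<in> E)"

definition graph_geodesic :: "('v \<times> 'v) set \<Rightarrow> 'v list \<Rightarrow> bool" where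
  "graph_geodesic E xs \<longleftrightarrow> edge_path E xs \<and> gdist E (hd xs) (last xs) = length xs - 1"

definition horoball_edges :: "'v set \<Rightarrow> ('v \<times> 'v) set \<Rightarrow> (('v \<times> nat) \<times> ('v \<times> nat)) set" where
  "horoball_edges V E =
     {((v, k), (w, k)) | v w k. v \<in> V \<and> w \<in> V \<and> 0 < gdist E v w \<and> gdist E v w \<le> 2 ^ k}
   \<union> {((v, k), (v, Suc k)) | v k. v \<in> V}
   \<union> {((v, Suc k), (v, k)) | v k. v \<in> V}"

text \<open>Steps between the indices \<open>a\<close> and \<open>b\<close> are horizontal, the remaining ones vertical;
  as the path is geodesic, each of the two vertical parts is a segment.\<close>

definition preferred_geodesic :: "'v set \<Rightarrow> ('v \<times> 'v) set \<Rightarrow> ('v \<times> nat) list \<Rightarrow> bool" where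
  "preferred_geodesic V E zs \<longleftrightarrow>
     set zs \<subseteq> V \<times> UNIV \<and> graph_geodesic (horoball_edges V E) zs \<and>
     (\<exists>a b. a \<le> b \<and> b < length zs \<and> b - a \<le> 3 \<and>
        (\<forall>i. Suc i < length zs \<longrightarrow>
           (if a \<le> i \<and> i < b then snd (zs ! i) = snd (zs ! Suc i)
            else fst (zs ! i) = fst (zs ! Suc i))))"

section \<open>The group, its peripheral subgroups and the cusped space\<close>

text \<open>Vertices of the cusped space: \<open>Cay g\<close> is the vertex \<open>g\<close> of the Cayley graph,
  \<open>Deep C v k\<close> with \<open>k > 0\<close> is the vertex \<open>(v, k)\<close> of the horoball on the
  peripheral coset \<open>C\<close>. Level \<open>0\<close> of each horoball is identified with a part of the
  Cayley graph (see \<open>glue\<close>), so \<open>Deep C v 0\<close> does not occur.\<close>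

datatype 'a cusped_vertex = Cay 'a | Deep "'a set" 'a nat

definition glue :: "'a set \<Rightarrow> 'a \<times> nat \<Rightarrow> 'a cusped_vertex" where
  "glue C = (\<lambda>(v, k). if k = 0 then Cay v else Deep C v k)"

definition horoball :: "'a set \<Rightarrow> 'a cusped_vertex set" where
  "horoball C = glue C ` (C \<times> UNIV)"

text \<open>Finite generation of the group and of the peripheral subgroups is witnessed by the
  finite set \<open>S\<close>.\<close>

locale peripheral_structure = group G for G :: "('a, 'b) monoid_scheme" (structure) +
  fixes \<P> :: "'a set set" and S :: "'a set"
  assumes torsion_free:
      "\<And>g n. \<lbrakk>g \<in> carrier G; g \<noteq> \<one>; 0 < n\<rbrakk> \<Longrightarrow> g [^] (n::nat) \<noteq> \<one>"
    and finite_peripherals: "finite \<P>"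
    and peripheral_subgroup: "\<And>P. P \<in> \<P> \<Longrightarrow> subgroup P G"
    and peripheral_proper: "\<And>P. P \<in> \<P> \<Longrightarrow> P \<noteq> carrier G"
    and peripheral_infinite: "\<And>P. P \<in> \<P> \<Longrightarrow> infinite P"
    and finite_S: "finite S"
    and S_carrier: "S \<subseteq> carrier G"
    and S_symmetric: "\<And>s. s \<in> S \<Longrightarrow> inv s \<in> S"
    and S_generates: "generate G S = carrier G"
    and S_generates_peripheral: "\<And>P. P \<in> \<P> \<Longrightarrow> generate G (S \<inter> P) = P"
begin

definition peripheral_cosets :: "'a set set" where
  "peripheral_cosets = {g <# P | g P. g \<in> carrier G \<and> P \<in> \<P>}"

definition peripheral :: "'a \<Rightarrow> bool" where
  "peripheral x \<longleftrightarrow> (\<exists>g\<in>carrier G. \<exists>P\<in>\<P>. \<exists>p\<in>P. x = g \<otimes> p \<otimes> inv g)"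

definition word_prod :: "'a list \<Rightarrow> 'a" where
  "word_prod w = foldr (\<otimes>) w \<one>"

definition word_length :: "'a set \<Rightarrow> 'a \<Rightarrow> nat" where
  "word_length A g = (LEAST n. \<exists>w. set w \<subseteq> A \<and> length w = n \<and> word_prod w = g)"

definition cayley_edges :: "('a \<times> 'a) set" where
  "cayley_edges = {(g, h). g \<in> carrier G \<and> h \<in> carrier G \<and> g \<noteq> h \<and> inv g \<otimes> h \<in> S}"

definition coset_edges :: "'a set \<Rightarrow> ('a \<times> 'a) set" where
  "coset_edges C = cayley_edges \<inter> C \<times> C"

definition cusped_edges :: "('a cusped_vertex \<times> 'a cusped_vertex) set" where
  "cusped_edges = map_prod Cay Cay ` cayley_edges
     \<union> (\<Union>C\<in>peripheral_cosets. map_prod (glue C) (glue C) ` horoball_edges C (coset_edges C))"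

definition cusped_length :: "'a \<Rightarrow> nat" where
  "cusped_length g = gdist cusped_edges (Cay \<one>) (Cay g)"

section \<open>Projected geodesics\<close>

definition excursion :: "'a cusped_vertex list \<Rightarrow> 'a set \<Rightarrow> nat \<Rightarrow> nat \<Rightarrow> bool" where
  "excursion xs C i j \<longleftrightarrow> C \<in> peripheral_cosets \<and> i \<le> j \<and> j < length xs \<and>
     (\<forall>k\<in>{i..j}. xs ! k \<in> horoball C) \<and>
     (i = 0 \<or> xs ! (i - 1) \<notin> horoball C) \<and>
     (Suc j = length xs \<or> xs ! Suc j \<notin> horoball C)"

definition preferred_excursions :: "'a cusped_vertex list \<Rightarrow> bool" where
  "preferred_excursions xs \<longleftrightarrow> (\<forall>C i j. excursion xs C i j \<longrightarrow>
     (\<exists>zs. preferred_geodesic C (coset_edges C) zs \<and>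
           map (glue C) zs = map (\<lambda>k. xs ! k) [i..<Suc j]))"

definition vertex_at :: "'a list \<Rightarrow> nat \<Rightarrow> 'a" where
  "vertex_at w k = word_prod (take k w)"

text \<open>The path \<open>xs\<close> starts at the identity and projects to the path traced by the word
  \<open>w\<close>. The map \<open>\<tau>\<close> matches positions on \<open>xs\<close> with positions on \<open>w\<close>: edges of
  \<open>xs\<close> outside of the horoballs are kept, and each excursion is replaced by a
  geodesic with the same endpoints in the Cayley graph of the peripheral coset.\<close>

definition projects_to :: "'a cusped_vertex list \<Rightarrow> 'a list \<Rightarrow> bool" where
  "projects_to xs w \<longleftrightarrow> hd xs = Cay \<one> \<and> last xs = Cay (word_prod w) \<and>
     (\<exists>\<tau>::nat \<Rightarrow> nat. mono_on {..<length xs} \<tau> \<and> \<tau> 0 = 0 \<and> \<tau> (length xs - 1) = length w \<and>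
        (\<forall>i. Suc i < length xs \<and>
             (\<nexists>C. C \<in> peripheral_cosets \<and> xs ! i \<in> horoball C \<and> xs ! Suc i \<in> horoball C) \<longrightarrow>
           \<tau> (Suc i) = Suc (\<tau> i) \<and>
           xs ! i = Cay (vertex_at w (\<tau> i)) \<and> xs ! Suc i = Cay (vertex_at w (\<tau> (Suc i)))) \<and>
        (\<forall>C i j. excursion xs C i j \<longrightarrow>
           xs ! i = Cay (vertex_at w (\<tau> i)) \<and> xs ! j = Cay (vertex_at w (\<tau> j)) \<and>
           set (map (vertex_at w) [\<tau> i..<Suc (\<tau> j)]) \<subseteq> C \<and>
           graph_geodesic (coset_edges C) (map (vertex_at w) [\<tau> i..<Suc (\<tau> j)])))"

definition projected_geodesic :: "'a list \<Rightarrow> bool" where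
  "projected_geodesic w \<longleftrightarrow> set w \<subseteq> S \<and>
     (\<exists>xs. graph_geodesic cusped_edges xs \<and> preferred_excursions xs \<and> projects_to xs w)"

section \<open>Metric quasigeodesic paths\<close>

text \<open>For a path in the Cayley graph defined on a real interval, only the set \<open>I\<close> of integer
  points of the interval and the restriction of the path to \<open>I\<close> are relevant.\<close>

definition same_coset :: "'a \<Rightarrow> 'a \<Rightarrow> bool" where
  "same_coset g h \<longleftrightarrow> (\<exists>C\<in>peripheral_cosets. g \<in> C \<and> h \<in> C)"

definition depth :: "int set \<Rightarrow> (int \<Rightarrow> 'a) \<Rightarrow> int \<Rightarrow> enat" where
  "depth I f n =
     (let leaves = (\<lambda>d::nat. \<exists>m\<in>{n - int d, n + int d} \<inter> I. \<not> same_coset (f n) (f m))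
      in if \<exists>d. leaves d then enat (LEAST d. leaves d)
         else min (SUP m\<in>{m \<in> I. n \<le> m}. enat (nat (m - n)))
                  (SUP m\<in>{m \<in> I. m \<le> n}. enat (nat (n - m))))"

definition metric_quasigeodesic :: "real \<Rightarrow> real \<Rightarrow> int set \<Rightarrow> (int \<Rightarrow> 'a) \<Rightarrow> bool" where
  "metric_quasigeodesic l u I f \<longleftrightarrow>
     (\<forall>a\<in>I. \<forall>b\<in>I. {a..b} \<subseteq> I) \<and> f ` I \<subseteq> carrier G \<and>
     (\<forall>m\<in>I. \<forall>n\<in>I.
        real (cusped_length (inv (f n) \<otimes> f m)) \<ge> inverse l * \<bar>real_of_int (m - n)\<bar> - l) \<and>
     (\<forall>m\<in>I. \<forall>n\<in>I.
        ereal (real (cusped_length (inv (f n) \<otimes> f m)))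
          \<le> ereal u * (ereal \<bar>real_of_int (m - n)\<bar>
                + min (ereal_of_enat (depth I f m)) (ereal_of_enat (depth I f n))) + ereal u) \<and>
     (\<forall>n P. n \<in> I \<and> n + 1 \<in> I \<and> P \<in> \<P> \<and> inv (f n) \<otimes> f (n + 1) \<in> P \<longrightarrow>
        (\<exists>ps k. set ps \<subseteq> S \<inter> P \<and> word_prod ps = inv (f n) \<otimes> f (n + 1) \<and>
              length ps = word_length S (inv (f n) \<otimes> f (n + 1)) \<and> depth I f n = enat k \<and>
              2 powr (real k - 1) \<le> real (length ps) \<and>
              real (length ps) \<le> 2 powr (real k + 1)))"

text \<open>A word is a metric quasigeodesic path if the path which it traces from the identity is one
  for a suitable parametrization.  By the last condition above, a peripheral step of a metric
  quasigeodesic path at depth \<open>k\<close> has word length about \<open>2 ^ k\<close>, so the unit speed parametrization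
  is not the one to use.\<close>

definition word_metric_quasigeodesic :: "real \<Rightarrow> real \<Rightarrow> 'a list \<Rightarrow> bool" where
  "word_metric_quasigeodesic l u w \<longleftrightarrow>
     (\<exists>N (\<phi>::nat \<Rightarrow> nat). mono_on {0..N} \<phi> \<and> \<phi> 0 = 0 \<and> \<phi> N = length w \<and>
        metric_quasigeodesic l u {0..int N} (\<lambda>n. vertex_at w (\<phi> (nat n))))"

section \<open>Condition (RH) and almost dominated representations\<close>

definition malnormality :: bool where
  "malnormality \<longleftrightarrow> (\<forall>g\<in>carrier G. \<forall>P\<in>\<P>. \<forall>P'\<in>\<P>. \<not> (g \<in> P \<and> P = P') \<longrightarrow>
     {g \<otimes> p \<otimes> inv g | p. p \<in> P} \<inter> P' = {\<one>})"

definition non_distortion :: bool where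
  "non_distortion \<longleftrightarrow> (\<exists>\<nu>>0. \<forall>g\<in>carrier G.
     \<not> peripheral g \<and> (\<forall>k::nat. 0 < k \<longrightarrow> g [^] k \<noteq> \<one>) \<longrightarrow>
       (\<forall>n::int. real (cusped_length (g [^] n)) \<ge> \<nu> * \<bar>real_of_int n\<bar>))"

definition local_to_global :: bool where
  "local_to_global \<longleftrightarrow> (\<exists>l>0. \<exists>u>0. \<exists>L::nat. 0 < L \<and>
     (\<forall>w p. \<forall>P\<in>\<P>. set w \<subseteq> S \<and>
        set p \<subseteq> S \<inter> P \<and> length p = word_length (S \<inter> P) (word_prod p) \<and> L < length p \<and>
        projected_geodesic (w @ take L p) \<longrightarrow> word_metric_quasigeodesic l u (w @ p)))"

definition RH :: bool where
  "RH \<longleftrightarrow> malnormality \<and> non_distortion \<and> local_to_global"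

end

definition general_linear_group :: "(real ^ 'n ^ 'n) monoid" where
  "general_linear_group = \<lparr>carrier = {A. invertible A}, mult = (**), one = mat 1\<rparr>"

text \<open>The multiplicity of \<open>s\<close> as a singular value of \<open>A\<close> is the multiplicity of
  \<open>s\<^sup>2\<close> as an eigenvalue of the symmetric matrix \<open>transpose A ** A\<close>.\<close>

definition singular_value_mult :: "real ^ 'n ^ 'n \<Rightarrow> real \<Rightarrow> nat" where
  "singular_value_mult A s =
     (if 0 \<le> s then dim {v. (transpose A ** A) *v v = s\<^sup>2 *\<^sub>R v} else 0)"

definition singular_values :: "real ^ 'n ^ 'n \<Rightarrow> real list" where
  "singular_values A = concat (map (\<lambda>s. replicate (singular_value_mult A s) s)
     (rev (sorted_list_of_set {s. 0 < singular_value_mult A s})))"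

text \<open>Singular values are numbered from 1, in decreasing order.\<close>

definition singular_value :: "nat \<Rightarrow> real ^ 'n ^ 'n \<Rightarrow> real" where
  "singular_value k A = singular_values A ! (k - 1)"

definition (in peripheral_structure) almost_dominated :: "('a \<Rightarrow> real ^ 'n ^ 'n) \<Rightarrow> bool" where
  "almost_dominated \<rho> \<longleftrightarrow> RH \<and>
     (\<exists>C>0. \<exists>\<mu>>0. \<forall>g\<in>carrier G.
        singular_value 1 (\<rho> g) / singular_value 2 (\<rho> g) \<ge> C * exp (\<mu> * real (cusped_length g)))"

end

theory Submission
  imports Defs
begin

text \<open>The cusped space is a connected locally finite graph, so only finitely many group elements
  have bounded cusped length. Near the identity matrix all singular values lie in
  \<open>[1/2, 3/2]\<close>, so by domination only finitely many group elements are mapped close to the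
  identity. By translation the image is discrete, and the kernel is a finite subgroup of a
  torsion-free group, hence trivial.\<close>

section \<open>Locally finite graphs\<close>

lemma finite_relpow_Image:
  fixes E :: "('v \<times> 'v) set"
  assumes "\<And>x. finite (E `` {x})"
  shows "finite ((E ^^ n) `` {x})"
proof (induction n)
  case (Suc n)
  have "(E ^^ Suc n) `` {x} = (\<Union>y\<in>(E ^^ n) `` {x}. E `` {y})"
    by auto
  then show ?case
    using Suc assms by simp
qed simp

text \<open>\<open>LEAST\<close> is attained only if some power of \<open>E\<close> links the two
  vertices; reachability supplies one.\<close>

lemma relpow_gdist:
  assumes "(x, y) \<in> E\<^sup>*"
  shows "(x, y) \<in> E ^^ gdist E x y"
  unfolding gdist_def using rtrancl_imp_relpow[OF assms] by (metis LeastI)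

text \<open>Reachability is part of the set because \<open>gdist\<close> to an unreachable vertex is
  an unspecified number that bounds nothing.\<close>

lemma finite_gdist_ball:
  assumes "\<And>x. finite (E `` {x})"
  shows "finite {y. (x, y) \<in> E\<^sup>* \<and> gdist E x y \<le> n}"
proof (rule finite_subset)
  show "{y. (x, y) \<in> E\<^sup>* \<and> gdist E x y \<le> n} \<subseteq> (\<Union>k\<in>{..n}. (E ^^ k) `` {x})"
    using relpow_gdist by fastforce
qed (auto intro: finite_relpow_Image assms)

section \<open>Properness of the cusped length\<close>

context peripheral_structure
begin

lemma finite_cayley_edges_Image: "finite (cayley_edges `` {g})"
proof (rule finite_subset)
  show "cayley_edges `` {g} \<subseteq> (\<lambda>s. g \<otimes> s) ` S"
  proof
    fix h assume "h \<in> cayley_edges `` {g}"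
    then have "g \<in> carrier G" "h \<in> carrier G" "inv g \<otimes> h \<in> S"
      by (auto simp: cayley_edges_def)
    moreover from this have "h = g \<otimes> (inv g \<otimes> h)"
      by (simp add: m_assoc[symmetric])
    ultimately show "h \<in> (\<lambda>s. g \<otimes> s) ` S"
      by blast
  qed
qed (simp add: finite_S)

text \<open>A word in the generators traces a path that stays in \<open>C\<close>, by closure under
  right multiplication. Leaving \<open>A\<close> and \<open>C\<close> free covers both a peripheral
  coset and the whole group.\<close>

lemma coset_edges_connected:
  assumes "h \<in> generate G A" "A \<subseteq> S"
    and "C \<subseteq> carrier G" "\<And>t a. t \<in> C \<Longrightarrow> a \<in> generate G A \<Longrightarrow> t \<otimes> a \<in> C" "t \<in> C"
  shows "(t, t \<otimes> h) \<in> (coset_edges C)\<^sup>*"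
proof -
  have step: "(t, t \<otimes> a) \<in> (coset_edges C)\<^sup>*" if "t \<in> C" "a \<in> S" "a \<in> generate G A" for t a
  proof -
    have c: "t \<in> carrier G" "a \<in> carrier G" "t \<otimes> a \<in> C"
      using that assms(3,4) S_carrier by auto
    then have "inv t \<otimes> (t \<otimes> a) = a"
      by (simp add: m_assoc[symmetric])
    \<comment> \<open>The Cayley graph has no loops, so the case of a trivial generator is
      separate.\<close>
    then have "t = t \<otimes> a \<or> (t, t \<otimes> a) \<in> coset_edges C"
      using c that by (auto simp: coset_edges_def cayley_edges_def)
    then show ?thesis
      by auto
  qed
  show ?thesis
    using assms(1,5)
  proof (induction arbitrary: t rule: generate.induct)
    case one
    then show ?case
      using assms(3) by (simp add: subsetD)
  next
    case (incl h)
    then show ?case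
      using step[OF incl(2) _ generate.incl[OF incl(1)]] assms(2) by blast
  next
    case (inv h)
    then show ?case
      using step[OF inv(2) _ generate.inv[OF inv(1)]] assms(2) S_symmetric by blast
  next
    case (eng h1 h2)
    have "(t, t \<otimes> h1) \<in> (coset_edges C)\<^sup>*" "(t \<otimes> h1, t \<otimes> h1 \<otimes> h2) \<in> (coset_edges C)\<^sup>*"
      using eng.IH(1)[OF eng.prems] eng.IH(2)[OF assms(4)[OF eng.prems eng.hyps(1)]]
      by simp_all
    moreover have "t \<otimes> h1 \<otimes> h2 = t \<otimes> (h1 \<otimes> h2)"
    proof -
      have "A \<subseteq> carrier G" "t \<in> carrier G"
        using assms(2,3) eng.prems S_carrier by auto
      then show ?thesis
        using eng.hyps by (simp add: m_assoc generate_in_carrier)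
    qed
    ultimately show ?case
      by (metis rtrancl_trans)
  qed
qed

text \<open>Makes \<open>gdist\<close> a genuine path distance on each coset, so that the bound
  \<open>2 ^ k\<close> on horizontal edges really limits the number of neighbours.\<close>

lemma peripheral_coset_connected:
  assumes C: "C \<in> peripheral_cosets" and "v \<in> C" "w \<in> C"
  shows "(v, w) \<in> (coset_edges C)\<^sup>*"
proof -
  obtain g P where g: "g \<in> carrier G" and P: "P \<in> \<P>" and CP: "C = g <# P"
    using C by (auto simp: peripheral_cosets_def)
  have sP: "subgroup P G"
    by (simp add: peripheral_subgroup P)
  \<comment> \<open>Any element represents its coset; rebasing at \<open>v\<close> makes
    \<open>w\<close> a right translate of \<open>v\<close> by an element of
    \<open>P\<close>.\<close>
  have v: "C = v <# P" "v \<in> carrier G"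
    using \<open>v \<in> C\<close> g sP CP l_repr_independence l_coset_carrier by blast+
  then obtain p where p: "p \<in> P" "w = v \<otimes> p"
    using assms by (auto simp: l_coset_def)
  show ?thesis
    unfolding p(2)
  proof (rule coset_edges_connected)
    show "p \<in> generate G (S \<inter> P)"
      using p P S_generates_peripheral by simp
    show "C \<subseteq> carrier G"
      using v sP by (auto simp: l_coset_def dest: subgroup.mem_carrier)
    show "t \<otimes> a \<in> C" if "t \<in> C" "a \<in> generate G (S \<inter> P)" for t a
    proof -
      have "t \<in> v <# P"
        using that(1) v(1) by simp
      then obtain p' where "p' \<in> P" "t = v \<otimes> p'"
        unfolding l_coset_def by blast
      moreover have "a \<in> P"
        using that P S_generates_peripheral by simp
      ultimately have "t \<otimes> a = v \<otimes> (p' \<otimes> a)" "p' \<otimes> a \<in> P"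
        using v sP by (simp_all add: m_assoc subgroup.mem_carrier subgroup.m_closed)
      then show ?thesis
        unfolding v(1) by (auto simp: l_coset_def)
    qed
  qed (use assms in auto)
qed

text \<open>Horizontal neighbours lie in a ball of the coset graph, which is locally finite as a
  subgraph of the Cayley graph; there are at most two vertical neighbours.\<close>

lemma finite_horoball_edges_Image:
  assumes "C \<in> peripheral_cosets"
  shows "finite (horoball_edges C (coset_edges C) `` {x})"
proof (cases x)
  case (Pair v k)
  have "finite (coset_edges C `` {u})" for u
    by (rule finite_subset[OF _ finite_cayley_edges_Image[of u]]) (auto simp: coset_edges_def)
  then have "finite {w. (v, w) \<in> (coset_edges C)\<^sup>* \<and> gdist (coset_edges C) v w \<le> 2 ^ k}"
    by (rule finite_gdist_ball)
  \<comment> \<open>At level \<open>0\<close> the truncated \<open>k - 1\<close> only adds the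
    vertex itself, which is harmless for an inclusion.\<close>
  moreover have "horoball_edges C (coset_edges C) `` {x} \<subseteq>
    (\<lambda>w. (w, k)) ` {w. (v, w) \<in> (coset_edges C)\<^sup>* \<and> gdist (coset_edges C) v w \<le> 2 ^ k}
      \<union> {(v, Suc k), (v, k - 1)}"
    using peripheral_coset_connected[OF assms] by (auto simp: horoball_edges_def Pair)
  ultimately show ?thesis
    by (meson finite.emptyI finite_Un finite_imageI finite_insert finite_subset)
qed

text \<open>A coset of \<open>P\<close> through \<open>g\<close> must be \<open>g <# P\<close>, so
  each \<open>P\<close> contributes only one.\<close>

lemma finite_peripheral_cosets_containing: "finite {C \<in> peripheral_cosets. g \<in> C}"
proof (rule finite_subset)
  show "{C \<in> peripheral_cosets. g \<in> C} \<subseteq> (\<lambda>P. g <# P) ` \<P>"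
    using l_repr_independence peripheral_subgroup by (force simp: peripheral_cosets_def)
qed (simp add: finite_peripherals)

text \<open>A Cayley vertex meets only the finitely many horoballs on cosets through it, while a
  deep vertex records the single horoball to which it belongs.\<close>

lemma finite_cusped_edges_Image: "finite (cusped_edges `` {x})"
proof (cases x)
  case (Cay g)
  let ?N = "\<lambda>C. glue C ` (horoball_edges C (coset_edges C) `` {(g, 0)})"
  have "cusped_edges `` {x} \<subseteq> Cay ` (cayley_edges `` {g})
    \<union> (\<Union>C\<in>{C \<in> peripheral_cosets. g \<in> C}. ?N C)"
  proof
    fix y assume "y \<in> cusped_edges `` {x}"
    then consider "y \<in> Cay ` (cayley_edges `` {g})"
      | C v k q where "C \<in> peripheral_cosets" "((v, k), q) \<in> horoball_edges C (coset_edges C)"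
        "Cay g = glue C (v, k)" "y = glue C q"
      unfolding cusped_edges_def Cay by auto
    then show "y \<in> Cay ` (cayley_edges `` {g}) \<union> (\<Union>C\<in>{C \<in> peripheral_cosets. g \<in> C}. ?N C)"
    proof cases
      case 2
      then have "v = g" "k = 0"
        by (auto simp: glue_def split: if_splits)
      moreover from this 2 have "g \<in> C"
        by (auto simp: horoball_edges_def)
      ultimately show ?thesis
        using 2 by blast
    qed auto
  qed
  moreover have "finite (Cay ` (cayley_edges `` {g})
    \<union> (\<Union>C\<in>{C \<in> peripheral_cosets. g \<in> C}. ?N C))"
    using finite_cayley_edges_Image finite_peripheral_cosets_containing finite_horoball_edges_Image
    by blast
  ultimately show ?thesis
    by (rule finite_subset)
next
  case (Deep D v k)
  have "cusped_edges `` {x} \<subseteq> glue D ` (horoball_edges D (coset_edges D) `` {(v, k)})"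
    unfolding cusped_edges_def Deep glue_def by (force split: if_splits)
  \<comment> \<open>The datatype also contains \<open>Deep D v k\<close> for sets \<open>D\<close>
    that are not peripheral cosets; such terms are isolated.\<close>
  moreover have "cusped_edges `` {x} = {}" if "D \<notin> peripheral_cosets"
    using that by (auto simp: cusped_edges_def Deep glue_def split: if_splits)
  ultimately show ?thesis
    using finite_horoball_edges_Image by (metis finite.emptyI finite_imageI finite_subset)
qed

lemma Cay_connected:
  assumes "g \<in> carrier G"
  shows "(Cay \<one>, Cay g) \<in> cusped_edges\<^sup>*"
proof -
  have "(\<one>, \<one> \<otimes> g) \<in> (coset_edges (carrier G))\<^sup>*"
    by (rule coset_edges_connected[where A = S]) (use assms S_generates in auto)
  then have "(\<one>, g) \<in> cayley_edges\<^sup>*"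
    using assms by (simp add: coset_edges_def)
      (metis (no_types, lifting) Int_lower1 rtrancl_mono subsetD)
  then show ?thesis
  proof (induction rule: rtrancl_induct)
    case (step y z)
    then have "(Cay y, Cay z) \<in> cusped_edges"
      by (force simp: cusped_edges_def)
    with step show ?case
      by (meson rtrancl.rtrancl_into_rtrancl)
  qed simp
qed

lemma finite_cusped_length_le: "finite {g \<in> carrier G. cusped_length g \<le> n}"
proof -
  have "Cay ` {g \<in> carrier G. cusped_length g \<le> n}
    \<subseteq> {y. (Cay \<one>, y) \<in> cusped_edges\<^sup>* \<and> gdist cusped_edges (Cay \<one>) y \<le> n}"
    using Cay_connected by (auto simp: cusped_length_def)
  then have "finite (Cay ` {g \<in> carrier G. cusped_length g \<le> n})"
    by (rule finite_subset) (intro finite_gdist_ball finite_cusped_edges_Image)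
  then show ?thesis
    by (rule finite_imageD) (auto simp: inj_on_def)
qed

text \<open>If two powers agreed, cancellation would give a trivial positive power, against
  torsion-freeness.\<close>

lemma infinite_powers:
  assumes "g \<in> carrier G" "g \<noteq> \<one>"
  shows "infinite (range (\<lambda>n::nat. g [^] n))"
proof -
  have "g [^] m \<noteq> g [^] n" if "m < n" for m n :: nat
  proof
    assume eq: "g [^] m = g [^] n"
    have "g [^] m \<otimes> g [^] (n - m) = g [^] n"
      using that assms by (simp add: nat_pow_mult)
    also have "\<dots> = g [^] m \<otimes> \<one>"
      using assms eq by simp
    finally have "g [^] (n - m) = \<one>"
      using assms by (metis Units_eq Units_l_cancel nat_pow_closed one_closed)
    then show False
      using torsion_free assms that by auto
  qed
  then have "inj (\<lambda>n::nat. g [^] n)"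
    by (metis injI linorder_neqE_nat)
  then show ?thesis
    by (rule range_inj_infinite)
qed

end

section \<open>Singular values near the identity\<close>

text \<open>A maximizer of \<open>f x \<bullet> x\<close> on the unit sphere is an eigenvector.\<close>

lemma self_adjoint_eigenvector:
  fixes f :: "'a::euclidean_space \<Rightarrow> 'a"
  assumes f: "linear f" and adj: "\<And>x y. f x \<bullet> y = x \<bullet> f y"
    and V: "subspace V" "f ` V \<subseteq> V" "V \<noteq> {0}"
  obtains v c where "v \<in> V" "v \<noteq> 0" "f v = c *\<^sub>R v"
proof -
  obtain u where u: "u \<in> V" "u \<noteq> 0"
    using V subspace_0 by blast
  have "compact (sphere 0 1 \<inter> V)"
    using V(1) by (simp add: closed_subspace compact_Int_closed)
  moreover have "(inverse (norm u)) *\<^sub>R u \<in> sphere 0 1 \<inter> V"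
    using u V(1) by (simp add: subspace_scale)
  moreover have "continuous_on (sphere 0 1 \<inter> V) (\<lambda>x. f x \<bullet> x)"
    by (intro continuous_intros linear_continuous_on linear_conv_bounded_linear[THEN iffD1] f)
  ultimately obtain v where v: "v \<in> sphere 0 1 \<inter> V"
    and max: "\<And>x. x \<in> sphere 0 1 \<inter> V \<Longrightarrow> f x \<bullet> x \<le> f v \<bullet> v"
    using continuous_attains_sup[of "sphere 0 1 \<inter> V" "\<lambda>x. f x \<bullet> x"] by blast
  define c where "c = f v \<bullet> v"
  \<comment> \<open>The quadratic form of \<open>c - f\<close>: nonnegative on \<open>V\<close> by
    maximality and scaling, and zero at \<open>v\<close>.\<close>
  define q where "q x = c * (x \<bullet> x) - f x \<bullet> x" for x
  have q_nonneg: "0 \<le> q x" if "x \<in> V" for x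
  proof (cases "x = 0")
    case False
    have "(inverse (norm x)) *\<^sub>R x \<in> sphere 0 1 \<inter> V"
      using False that V(1) by (simp add: subspace_scale)
    from max[OF this] have "(f x \<bullet> x) / (norm x)\<^sup>2 \<le> c"
      by (simp add: linear_cmul[OF f] c_def power2_eq_square divide_inverse mult_ac)
    then show ?thesis
      using False by (simp add: q_def power2_norm_eq_inner[symmetric] field_simps)
  qed (simp add: q_def linear_0[OF f])
  \<comment> \<open>Half the gradient of \<open>q\<close> at \<open>v\<close>. If it were nonzero, a
    short step from \<open>v\<close> in the direction \<open>- w\<close> would make \<open>q\<close>
    negative.\<close>
  define w where "w = c *\<^sub>R v - f v"
  have wV: "w \<in> V"
    using v V by (auto simp: w_def intro!: subspace_diff subspace_scale)
  have vv: "v \<bullet> v = 1"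
    using v by (simp add: norm_eq_1)
  have expand: "q (v - t *\<^sub>R w) = - 2 * t * (w \<bullet> w) + t\<^sup>2 * q w" for t
  proof -
    have "w \<bullet> w = c * (w \<bullet> v) - w \<bullet> f v"
      by (subst (2) w_def) (simp add: inner_diff_right)
    then have fv: "w \<bullet> f v = c * (w \<bullet> v) - w \<bullet> w"
      by simp
    then have "f w \<bullet> v = c * (w \<bullet> v) - w \<bullet> w"
      by (simp add: adj)
    moreover have "q (v - t *\<^sub>R w) = c - 2 * t * (c * (w \<bullet> v)) + t\<^sup>2 * (c * (w \<bullet> w))
        - (c - t * (w \<bullet> f v) - t * (f w \<bullet> v) + t\<^sup>2 * (f w \<bullet> w))"
      by (simp add: q_def linear_diff[OF f] linear_cmul[OF f] inner_diff_left inner_diff_right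
          vv c_def[symmetric] inner_commute[of v w] inner_commute[of "f v" w] power2_eq_square
          algebra_simps)
    moreover have "q w = c * (w \<bullet> w) - f w \<bullet> w"
      by (simp add: q_def)
    ultimately show ?thesis
      unfolding fv by (simp only:) (simp add: algebra_simps)
  qed
  have "w \<bullet> w = 0"
  proof (rule ccontr)
    assume "w \<bullet> w \<noteq> 0"
    then have pos: "0 < w \<bullet> w"
      using inner_ge_zero[of w] by linarith
    have ineq: "2 * t * (w \<bullet> w) \<le> t\<^sup>2 * q w" for t
      using q_nonneg[of "v - t *\<^sub>R w"] v wV V(1) expand[of t]
      by (simp add: subspace_diff subspace_scale)
    \<comment> \<open>Positivity permits division by \<open>q w\<close>; the value of
      \<open>t\<close> used next minimizes the quadratic polynomial in
      \<open>expand\<close>.\<close>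
    have "0 < q w"
      using ineq[of 1] pos by (simp only: power_one mult_1 mult_1_right)
    with ineq[of "(w \<bullet> w) / q w"] have "(w \<bullet> w) * (w \<bullet> w) \<le> 0"
      by (simp add: power2_eq_square field_simps)
    with mult_pos_pos[OF pos pos] show False
      by linarith
  qed
  then have "f v = c *\<^sub>R v"
    by (simp add: w_def)
  moreover have "v \<noteq> 0"
    using v by auto
  ultimately show thesis
    using that v by blast
qed

section \<open>Singular values as square roots of eigenvalues of the Gram matrix\<close>

lemma inner_transpose_mult:
  fixes A :: "real ^ 'n ^ 'n"
  shows "((transpose A ** A) *v x) \<bullet> y = (A *v x) \<bullet> (A *v y)"
  by (metis dot_lmul_matrix inner_commute matrix_vector_mul_assoc transpose_matrix_vector)

lemma singular_value_mult_pos_iff: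
  fixes A :: "real ^ 'n ^ 'n"
  shows "0 < singular_value_mult A s \<longleftrightarrow>
    0 \<le> s \<and> (\<exists>v. v \<noteq> 0 \<and> (transpose A ** A) *v v = s\<^sup>2 *\<^sub>R v)"
proof -
  let ?V = "{v. (transpose A ** A) *v v = s\<^sup>2 *\<^sub>R v}"
  have "0 < dim ?V \<longleftrightarrow> \<not> ?V \<subseteq> {0}"
    by (simp only: dim_eq_0[symmetric] neq0_conv)
  then show ?thesis
    unfolding singular_value_mult_def by auto
qed

text \<open>Eigenvectors for distinct singular values are orthogonal, and an orthogonal family in
  finite dimension is finite. Finiteness is what makes \<open>sorted_list_of_set\<close> list the
  actual singular values.\<close>

lemma finite_singular_values:
  fixes A :: "real ^ 'n ^ 'n"
  shows "finite {s. 0 < singular_value_mult A s}"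
proof -
  let ?M = "transpose A ** A" and ?E = "{s. 0 < singular_value_mult A s}"
  have "\<forall>s\<in>?E. \<exists>v. v \<noteq> 0 \<and> ?M *v v = s\<^sup>2 *\<^sub>R v"
    by (simp add: singular_value_mult_pos_iff)
  then obtain v where v: "\<And>s. s \<in> ?E \<Longrightarrow> v s \<noteq> 0 \<and> ?M *v v s = s\<^sup>2 *\<^sub>R v s"
    by (metis (no_types, lifting))
  have orth: "v s \<bullet> v t = 0" if "s \<in> ?E" "t \<in> ?E" "s \<noteq> t" for s t
  proof -
    have "s\<^sup>2 * (v s \<bullet> v t) = t\<^sup>2 * (v s \<bullet> v t)"
      using inner_transpose_mult[of A "v s" "v t"] inner_transpose_mult[of A "v t" "v s"] v that
      by (simp add: inner_commute)
    \<comment> \<open>Squaring is injective here because singular values are nonnegative.\<close>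
    moreover have "s\<^sup>2 \<noteq> t\<^sup>2"
      using that by (simp add: singular_value_mult_pos_iff)
    ultimately show ?thesis
      by simp
  qed
  have "inj_on v ?E"
  proof (rule inj_onI, rule ccontr)
    fix s t assume "s \<in> ?E" "t \<in> ?E" "v s = v t" "s \<noteq> t"
    then show False
      using orth[of s t] v[of t] by simp
  qed
  moreover have "finite (v ` ?E)"
    by (rule pairwise_orthogonal_imp_finite)
      (auto simp: pairwise_def orthogonal_def intro!: orth)
  ultimately show ?thesis
    by (rule finite_imageD[rotated])
qed

lemma length_singular_values:
  fixes A :: "real ^ 'n ^ 'n"
  shows "length (singular_values A) = (\<Sum>s | 0 < singular_value_mult A s. singular_value_mult A s)"
proof -
  have "length (singular_values A)
    = sum_list (map (singular_value_mult A) (sorted_list_of_set {s. 0 < singular_value_mult A s}))"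
    by (simp add: singular_values_def length_concat comp_def rev_map[symmetric])
  then show ?thesis
    by (simp add: sum_list_distinct_conv_sum_set finite_singular_values)
qed

lemma set_singular_values:
  fixes A :: "real ^ 'n ^ 'n"
  shows "set (singular_values A) = {s. 0 < singular_value_mult A s}"
  by (auto simp: singular_values_def finite_singular_values)

text \<open>Ensures that \<open>singular_value 2\<close> reads a genuine list entry. Instead of a
  full diagonalization, one eigenvector is found in the whole space and a second in its orthogonal
  hyperplane, which is invariant by self-adjointness.\<close>

lemma two_le_length_singular_values:
  fixes A :: "real ^ 'n ^ 'n"
  assumes "2 \<le> CARD('n)"
  shows "2 \<le> length (singular_values A)"
proof -
  let ?M = "transpose A ** A"
  let ?f = "\<lambda>x. ?M *v x"
  have adj: "?f x \<bullet> y = x \<bullet> ?f y" for x y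
    by (metis inner_commute inner_transpose_mult)
  have eig: "0 \<le> c" if "v \<noteq> 0" "?f v = c *\<^sub>R v" for v c
  proof -
    have "c * (v \<bullet> v) = (A *v v) \<bullet> (A *v v)"
      using inner_transpose_mult[of A v v] that by simp
    then show ?thesis
      using that by (metis inner_ge_zero inner_gt_zero_iff zero_le_mult_iff not_le)
  qed
  have "(UNIV :: (real ^ 'n) set) \<noteq> {0}"
    by (metis UNIV_I axis_eq_0_iff singletonD zero_neq_one)
  then obtain v c where v: "v \<noteq> 0" "?f v = c *\<^sub>R v"
    by (rule self_adjoint_eigenvector[of ?f UNIV, rotated 4]) (auto simp: adj)
  let ?W = "{w. v \<bullet> w = 0}"
  have "dim ?W = CARD('n) - 1"
    using v by (simp add: dim_hyperplane)
  then have W: "?W \<noteq> {0}"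
    using assms by (metis One_nat_def dim_singleton diff_is_0_eq not_less_eq_eq numeral_2_eq_2 dim_eq_0 subset_refl)
  have "?f w \<in> ?W" if "w \<in> ?W" for w
    using adj[of v w] v that by simp
  then obtain w d where w: "w \<in> ?W" "w \<noteq> 0" "?f w = d *\<^sub>R w"
    by (rule_tac self_adjoint_eigenvector[of ?f ?W]) (auto simp: adj subspace_hyperplane W)
  have c: "0 < singular_value_mult A (sqrt c)" and d: "0 < singular_value_mult A (sqrt d)"
    using v w eig by (auto simp: singular_value_mult_pos_iff)
  \<comment> \<open>Equal eigenvalues give one singular value of multiplicity at least two;
    different ones give two distinct entries.\<close>
  show ?thesis
  proof (cases "c = d")
    case True
    have "pairwise orthogonal {v, w}"
      using w(1) by (auto simp: pairwise_def orthogonal_def inner_commute)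
    then have "independent {v, w}"
      using v w by (intro pairwise_orthogonal_independent) auto
    then have "card {v, w} \<le> dim {x. ?M *v x = c *\<^sub>R x}"
      using v w True by (intro independent_card_le_dim) auto
    moreover have "v \<noteq> w"
      using w v by auto
    ultimately have "2 \<le> singular_value_mult A (sqrt c)"
      using eig[OF v] by (simp add: singular_value_mult_def)
    also have "\<dots> \<le> length (singular_values A)"
      unfolding length_singular_values
      using c by (intro member_le_sum) (auto simp: finite_singular_values)
    finally show ?thesis .
  next
    case False
    then have "2 \<le> (\<Sum>s\<in>{sqrt c, sqrt d}. singular_value_mult A s)"
      using c d by simp
    also have "\<dots> \<le> length (singular_values A)"
      unfolding length_singular_values
      using c d by (intro sum_mono2) (auto simp: finite_singular_values)
    finally show ?thesis .
  qed
qed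

text \<open>The norm of a matrix is the Frobenius norm; Cauchy-Schwarz on each row shows that it
  dominates the operator norm.\<close>

lemma norm_matrix_vector_mult_le:
  fixes A :: "real ^ 'n ^ 'm"
  shows "norm (A *v x) \<le> norm A * norm x"
proof -
  have "norm (A *v x) \<le> L2_set (\<lambda>i. norm (A $ i) * norm x) UNIV"
    unfolding norm_vec_def[of "A *v x"]
    by (rule L2_set_mono) (auto simp: matrix_vector_mul_component Cauchy_Schwarz_ineq2)
  then show ?thesis
    by (simp add: L2_set_left_distrib norm_vec_def[of A])
qed

text \<open>An eigenvector \<open>v\<close> of the Gram matrix for \<open>s\<^sup>2\<close> is
  stretched by exactly \<open>s\<close>, while \<open>A\<close> moves it by at most half its norm;
  hence \<open>s\<close> differs from 1 by at most \<open>1 / 2\<close>.\<close>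

lemma singular_value_near_identity:
  fixes A :: "real ^ 'n ^ 'n"
  assumes "norm (A - mat 1) \<le> 1 / 2" "0 < singular_value_mult A s"
  shows "1 / 2 \<le> s" "s \<le> 3 / 2"
proof -
  obtain v where s: "0 \<le> s" and v: "v \<noteq> 0" "(transpose A ** A) *v v = s\<^sup>2 *\<^sub>R v"
    using assms(2) by (auto simp: singular_value_mult_pos_iff)
  have "(norm (A *v v))\<^sup>2 = (s * norm v)\<^sup>2"
    using inner_transpose_mult[of A v v] v
    by (simp add: power2_norm_eq_inner power_mult_distrib)
  then have Av: "norm (A *v v) = s * norm v"
    using s by (simp add: power2_eq_iff_nonneg)
  have "norm (A *v v - v) \<le> norm (A - mat 1) * norm v"
    using norm_matrix_vector_mult_le[of "A - mat 1" v]
    by (simp add: matrix_vector_mult_diff_rdistrib)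
  also have "\<dots> \<le> 1 / 2 * norm v"
    using assms(1) by (intro mult_right_mono) auto
  finally have "\<bar>s * norm v - norm v\<bar> \<le> 1 / 2 * norm v"
    using norm_triangle_ineq3[of "A *v v" v] Av by linarith
  then have "1 / 2 * norm v \<le> s * norm v" "s * norm v \<le> 3 / 2 * norm v"
    by linarith+
  then show "1 / 2 \<le> s" "s \<le> 3 / 2"
    using v by simp_all
qed

lemma singular_value_ratio_near_identity:
  fixes A :: "real ^ 'n ^ 'n"
  assumes "2 \<le> CARD('n)" "norm (A - mat 1) \<le> 1 / 2"
  shows "singular_value 1 A / singular_value 2 A \<le> 3"
proof -
  have "singular_value k A \<in> set (singular_values A)" if "k \<in> {1, 2}" for k
    using two_le_length_singular_values[OF assms(1), of A] that
    by (auto simp: singular_value_def intro!: nth_mem)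
  then have "singular_value 1 A \<le> 3 / 2" "1 / 2 \<le> singular_value 2 A"
    using singular_value_near_identity[OF assms(2)] by (auto simp: set_singular_values)
  then show ?thesis
    by (simp add: divide_le_eq)
qed

section \<open>Representations\<close>

text \<open>Near the identity the singular value ratio is at most 3, so domination bounds the cusped
  length, and only finitely many elements satisfy such a bound.\<close>

lemma (in peripheral_structure) finite_near_identity:
  fixes \<rho> :: "'a \<Rightarrow> real ^ 'n ^ 'n"
  assumes "2 \<le> CARD('n)" "almost_dominated \<rho>"
  shows "finite {g \<in> carrier G. norm (\<rho> g - mat 1) \<le> 1 / 2}"
proof -
  obtain C \<mu> where C: "0 < C" and \<mu>: "0 < \<mu>" and dom: "\<And>g. g \<in> carrier G \<Longrightarrow>
      C * exp (\<mu> * real (cusped_length g)) \<le> singular_value 1 (\<rho> g) / singular_value 2 (\<rho> g)"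
    using assms(2) by (auto simp: almost_dominated_def)
  \<comment> \<open>The bound solves \<open>C * exp (\<mu> * x) = 3\<close> for \<open>x\<close> and
    rounds down.\<close>
  have "cusped_length g \<le> nat \<lfloor>ln (3 / C) / \<mu>\<rfloor>"
    if "g \<in> carrier G" "norm (\<rho> g - mat 1) \<le> 1 / 2" for g
  proof -
    have "C * exp (\<mu> * real (cusped_length g)) \<le> 3"
      using dom[OF that(1)] singular_value_ratio_near_identity[OF assms(1) that(2)] by linarith
    then have "exp (\<mu> * real (cusped_length g)) \<le> 3 / C"
      using C by (simp add: field_simps)
    then have "\<mu> * real (cusped_length g) \<le> ln (3 / C)"
      using C by (simp add: ln_ge_iff)
    then have "real (cusped_length g) \<le> ln (3 / C) / \<mu>"
      using \<mu> by (simp add: field_simps)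
    then show ?thesis
      by (simp add: le_nat_floor)
  qed
  then show ?thesis
    by (intro finite_subset[OF _ finite_cusped_length_le]) auto
qed

text \<open>The image of the identity is an invertible idempotent matrix.\<close>

lemma hom_general_linear_group_one:
  fixes \<rho> :: "'a \<Rightarrow> real ^ 'n ^ 'n"
  assumes "group G" "\<rho> \<in> hom G general_linear_group"
  shows "\<rho> \<one>\<^bsub>G\<^esub> = mat 1"
proof -
  interpret group G by fact
  have "\<rho> \<one>\<^bsub>G\<^esub> ** \<rho> \<one>\<^bsub>G\<^esub> = \<rho> \<one>\<^bsub>G\<^esub>"
    using hom_mult[OF assms(2), of "\<one>\<^bsub>G\<^esub>" "\<one>\<^bsub>G\<^esub>"] by (simp add: general_linear_group_def)
  moreover have "invertible (\<rho> \<one>\<^bsub>G\<^esub>)"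
    using hom_in_carrier[OF assms(2), of "\<one>\<^bsub>G\<^esub>"] by (simp add: general_linear_group_def)
  then obtain B where "B ** \<rho> \<one>\<^bsub>G\<^esub> = mat 1"
    unfolding invertible_def by blast
  ultimately show ?thesis
    by (metis matrix_mul_assoc matrix_mul_lid)
qed

theorem proposition4p5:
  fixes G :: "('a, 'b) monoid_scheme"
    and \<P> :: "'a set set"
    and S :: "'a set"
    and \<rho> :: "'a \<Rightarrow> real ^ 'n ^ 'n"
  assumes "peripheral_structure G \<P> S"
    and "2 \<le> CARD('n)"
    and "\<rho> \<in> hom G general_linear_group"
    and "peripheral_structure.almost_dominated G \<P> S \<rho>"
  shows "discrete (\<rho> ` carrier G) \<and> inj_on \<rho> (carrier G)"
proof
  interpret peripheral_structure G \<P> S by fact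
  let ?F = "{g \<in> carrier G. norm (\<rho> g - mat 1) \<le> 1 / 2}"
  have fin: "finite ?F"
    using finite_near_identity assms(2,4) by blast
  have mult: "\<rho> (x \<otimes>\<^bsub>G\<^esub> y) = \<rho> x ** \<rho> y" if "x \<in> carrier G" "y \<in> carrier G" for x y
    using hom_mult[OF assms(3) that] by (simp add: general_linear_group_def)
  have one: "\<rho> \<one>\<^bsub>G\<^esub> = mat 1"
    using hom_general_linear_group_one assms(3) is_group by blast
  have inv_mult: "\<rho> (inv\<^bsub>G\<^esub> g) ** \<rho> g = mat 1" if "g \<in> carrier G" for g
    using mult[of "inv\<^bsub>G\<^esub> g" g] that by (simp add: one)
  have kernel: "g = \<one>\<^bsub>G\<^esub>" if g: "g \<in> carrier G" "\<rho> g = mat 1" for g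
  proof (rule ccontr)
    assume "g \<noteq> \<one>\<^bsub>G\<^esub>"
    \<comment> \<open>A nontrivial kernel element would put infinitely many powers into the finite
      set \<open>?F\<close>.\<close>
    have "\<rho> (g [^]\<^bsub>G\<^esub> n) = mat 1" for n :: nat
      by (induction n) (simp_all add: one mult g)
    then have "range (\<lambda>n::nat. g [^]\<^bsub>G\<^esub> n) \<subseteq> ?F"
      using g by auto
    then show False
      using infinite_powers[OF g(1) \<open>g \<noteq> \<one>\<^bsub>G\<^esub>\<close>] fin finite_subset by blast
  qed
  show "inj_on \<rho> (carrier G)"
  proof (rule inj_onI)
    fix g h assume gh: "g \<in> carrier G" "h \<in> carrier G" "\<rho> g = \<rho> h"
    then have "\<rho> (inv\<^bsub>G\<^esub> h \<otimes>\<^bsub>G\<^esub> g) = mat 1"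
      by (simp add: mult inv_mult)
    then have "inv\<^bsub>G\<^esub> h \<otimes>\<^bsub>G\<^esub> g = \<one>\<^bsub>G\<^esub>"
      using gh kernel by simp
    then show "g = h"
      using gh by (metis inv_equality inv_closed inv_inv)
  qed
  show "discrete (\<rho> ` carrier G)"
  proof (rule discreteI)
    fix X assume "X \<in> \<rho> ` carrier G"
    then obtain g where g: "g \<in> carrier G" "X = \<rho> g"
      by blast
    \<comment> \<open>Left translation by \<open>\<rho> g\<close> carries the open ball of radius
      \<open>1 / 2\<close> about the identity to this neighbourhood of \<open>X\<close>.\<close>
    let ?T = "{Y. norm (\<rho> (inv\<^bsub>G\<^esub> g) ** Y - mat 1) < 1 / 2}"
    have "linear (\<lambda>Y. \<rho> (inv\<^bsub>G\<^esub> g) ** Y)"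
      by (rule linearI) (simp_all add: matrix_add_ldistrib scalar_matrix_assoc
          matrix_scalar_ac flip: scalar_matrix_assoc)
    then have "continuous_on UNIV (\<lambda>Y. \<rho> (inv\<^bsub>G\<^esub> g) ** Y)"
      using linear_continuous_on linear_conv_bounded_linear by blast
    then have "open ?T"
      by (intro open_Collect_less continuous_intros)
    have "h \<in> (\<lambda>x. g \<otimes>\<^bsub>G\<^esub> x) ` ?F" if "h \<in> carrier G" "\<rho> h \<in> ?T" for h
    proof
      show "h = g \<otimes>\<^bsub>G\<^esub> (inv\<^bsub>G\<^esub> g \<otimes>\<^bsub>G\<^esub> h)"
        using that g by (simp add: m_assoc[symmetric])
      show "inv\<^bsub>G\<^esub> g \<otimes>\<^bsub>G\<^esub> h \<in> ?F"
        using that g by (simp add: mult)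
    qed
    then have "?T \<inter> \<rho> ` carrier G \<subseteq> \<rho> ` (\<lambda>x. g \<otimes>\<^bsub>G\<^esub> x) ` ?F"
      by blast
    then have "finite (?T \<inter> \<rho> ` carrier G)"
      using fin finite_subset by blast
    \<comment> \<open>Deleting the finitely many other image points from \<open>?T\<close> leaves an
      open set that meets the image only in \<open>X\<close>.\<close>
    then have "open (?T - (?T \<inter> \<rho> ` carrier G - {X}))"
      using \<open>open ?T\<close> by (intro open_Diff finite_imp_closed) auto
    moreover have "X \<in> ?T"
      using g by (simp add: inv_mult)
    ultimately show "X isolated_in \<rho> ` carrier G"
      using g by (intro isolated_inI[where T = "?T - (?T \<inter> \<rho> ` carrier G - {X})"]) auto
  qed
qed

end
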